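(* When the matrix $B$ is finite, all its eigenvalues have a negative real part.
   Context: Let $\ell\ge1$ be finite. $B$ is the $(\ell+1)\times(\ell+1)$ matrix with rows and columns indexed by $0,\ldots,\ell$ defined as follows. Let $b_i^d,b_i^u,b_i^z$ be non-negative reals with $b_0^d>0$, $b_\ell^u=0$, and $b_i^w=b_i^z+b_i^d+b_i^u>0$ for $1\le i\le\ell$. Then $B(0,0)=-b_0^d-b_0^u$, $B(0,1)=b_0^u$; $B(1,0)=b_1^d+b_1^z$, $B(1,1)=-b_1^w$, $B(1,2)=b_1^u$ (if $\ell\ge2$); for $2\le i\le\ell$: $B(i,0)=b_i^z$, $B(i,i-1)=b_i^d$, $B(i,i)=-b_i^w$ and, if $i<\ell$, $B(i,i+1)=b_i^u$; all other entries are $0$. (Thus every row sum is $0$ except that of row $0$, which is $-b_0^d$.) Standing assumption: $b_i^d\,b_{i-1}^u>0$ for all $1\le i\le\ell$. *)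

theory Defs
  imports Complex_Main "Jordan_Normal_Form.Char_Poly"
begin

definition bw :: "(nat \<Rightarrow> real) \<Rightarrow> (nat \<Rightarrow> real) \<Rightarrow> (nat \<Rightarrow> real) \<Rightarrow> nat \<Rightarrow> real" where
  "bw bd bu bz i = bz i + bd i + bu i"

definition B_entry :: "(nat \<Rightarrow> real) \<Rightarrow> (nat \<Rightarrow> real) \<Rightarrow> (nat \<Rightarrow> real) \<Rightarrow> nat \<Rightarrow> nat \<Rightarrow> real" where
  "B_entry bd bu bz i j =
    (if i = 0 then
       (if j = 0 then - bd 0 - bu 0
        else if j = 1 then bu 0
        else 0)
     else if i = 1 then
       (if j = 0 then bd 1 + bz 1
        else if j = 1 then - bw bd bu bz 1
        else if j = 2 then bu 1
        else 0)
     else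
       (if j = 0 then bz i
        else if j = i - 1 then bd i
        else if j = i then - bw bd bu bz i
        else if j = i + 1 then bu i
        else 0))"

(* The side conditions "if l >= 2" on B(1,2) and "if i < l" on B(i,i+1) are
   enforced by the dimension: column l + 1 is not part of the matrix. *)
definition B_mat :: "nat \<Rightarrow> (nat \<Rightarrow> real) \<Rightarrow> (nat \<Rightarrow> real) \<Rightarrow> (nat \<Rightarrow> real) \<Rightarrow> real mat" where
  "B_mat l bd bu bz = mat (l + 1) (l + 1) (\<lambda>(i, j). B_entry bd bu bz i j)"

end

theory Submission
  imports Defs
begin

text \<open>
  The matrix is a sub-generator: its off-diagonal entries are non-negative and no row sum is
  positive, so the eigenvalues obey a maximum principle. Suppose that an eigenvalue had
  non-negative real part, and look at the entries of maximal modulus of an eigenvector. In such a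
  row the eigenvalue equation says that a non-negative quantity equals a sum of non-positive
  ones. Hence the row sum is zero, and the modulus is again maximal at every
  column where the row has a positive entry (\<open>eigenvector_maximum_principle\<close>). Following positive
  entries therefore never leaves the set of maximal rows. If every row can reach a row of
  negative sum in this way, this is impossible
  (\<open>Re_eigenvalue_neg_of_leaking_subgenerator\<close>).

  For the matrix \<open>B\<close>, the only row that leaks is row \<open>0\<close>, with row sum \<open>- bd 0\<close>, and it is
  reached from every other row by descending one step at a time along the subdiagonal, which is
  positive because the products \<open>bd i * bu (i - 1)\<close> are.
\<close>

section \<open>A maximum principle for sub-generators\<close>

text \<open>
  Write \<open>s\<close> for the row sum at \<open>i\<close>. Multiplying the \<open>i\<close>-th eigenvalue equation by the conjugate of
  the entry \<open>v i\<close> and subtracting \<open>s\<close> times the squared modulus of \<open>v i\<close> gives, in real parts,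
  \<open>(Re k - s) * (cmod (v i))\<^sup>2 = (\<Sum>j. a j * (Re (v j * cnj (v i)) - (cmod (v i))\<^sup>2))\<close>.
  The diagonal term on the right vanishes and, by maximality of \<open>v i\<close>, the others are
  non-positive, while the left side is non-negative. So both sides are zero.
\<close>

lemma eigenvector_maximum_principle:
  fixes a :: "nat \<Rightarrow> real" and v :: "nat \<Rightarrow> complex" and k :: complex
  assumes eq: "(\<Sum>j<n. of_real (a j) * v j) = k * v i"
    and off_diag: "\<And>j. j < n \<Longrightarrow> j \<noteq> i \<Longrightarrow> a j \<ge> 0"
    and row_sum: "(\<Sum>j<n. a j) \<le> 0"
    and max: "\<And>j. j < n \<Longrightarrow> cmod (v j) \<le> cmod (v i)"
    and nonzero: "v i \<noteq> 0"
    and Re_k: "Re k \<ge> 0"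
  shows "(\<Sum>j<n. a j) = 0"
    and "j < n \<Longrightarrow> a j > 0 \<Longrightarrow> cmod (v j) = cmod (v i)"
proof -
  define M where "M = cmod (v i)"
  define t where "t j = a j * (Re (v j * cnj (v i)) - M\<^sup>2)" for j
  have M_pos: "M > 0"
    using nonzero by (simp add: M_def)
  \<comment> \<open>Below, \<open>times_complex.sel\<close> is kept out of the simplifier so that \<open>Re (v j * cnj (v i))\<close>, which
    is compared with \<open>cmod (v j) * M\<close>, is not expanded into real and imaginary parts.\<close>
  have M_sq: "v i * cnj (v i) = of_real (M\<^sup>2)"
    by (simp only: M_def complex_norm_square)
  have Re_of_real_mult: "Re (of_real x * z) = x * Re z"
    and Re_mult_of_real: "Re (z * of_real x) = Re z * x" for x z
    by simp_all
  have Re_le: "Re (v j * cnj (v i)) \<le> cmod (v j) * M" for j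
    using complex_Re_le_cmod[of "v j * cnj (v i)"] by (simp add: norm_mult M_def)
  have t_nonpos: "t j \<le> 0" if "j < n" for j
  proof (cases "j = i")
    case True
    then show ?thesis by (simp add: t_def M_sq del: of_real_power)
  next
    case False
    have "cmod (v j) * M \<le> M\<^sup>2"
      using max[OF that] M_pos by (simp add: M_def power2_eq_square mult_right_mono)
    then have "Re (v j * cnj (v i)) \<le> M\<^sup>2"
      using Re_le[of j] by linarith
    then show ?thesis
      using off_diag[OF that False] by (simp add: t_def mult_nonneg_nonpos del: times_complex.sel)
  qed
  have "(\<Sum>j<n. of_real (a j) * (v j * cnj (v i))) = k * of_real (M\<^sup>2)"
    using arg_cong[OF eq, of "\<lambda>z. z * cnj (v i)"]
    by (simp add: sum_distrib_right mult.assoc M_sq del: of_real_power)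
  from arg_cong[OF this, of Re]
  have "(\<Sum>j<n. a j * Re (v j * cnj (v i))) = Re k * M\<^sup>2"
    by (simp only: Re_sum Re_of_real_mult Re_mult_of_real)
  then have sum_t: "(\<Sum>j<n. t j) = (Re k - (\<Sum>j<n. a j)) * M\<^sup>2"
    by (simp add: t_def right_diff_distrib left_diff_distrib sum_subtractf sum_distrib_right
        del: times_complex.sel)
  have "(\<Sum>j<n. t j) \<le> 0"
    by (rule sum_nonpos) (use t_nonpos in auto)
  moreover have "(Re k - (\<Sum>j<n. a j)) * M\<^sup>2 \<ge> 0"
    using Re_k row_sum by simp
  ultimately have zero: "(\<Sum>j<n. t j) = 0" "(Re k - (\<Sum>j<n. a j)) * M\<^sup>2 = 0"
    using sum_t by linarith+
  show "(\<Sum>j<n. a j) = 0"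
    using zero(2) M_pos Re_k row_sum by simp
  show "cmod (v j) = cmod (v i)" if "j < n" "a j > 0"
  proof -
    have "t j = 0"
      using zero(1) t_nonpos that(1) sum_nonneg_eq_0_iff[of "{..<n}" "\<lambda>j. - t j"]
      by (simp add: sum_negf)
    then have "Re (v j * cnj (v i)) = M\<^sup>2"
      using that(2) by (simp add: t_def del: times_complex.sel)
    then have "M * M \<le> cmod (v j) * M"
      using Re_le[of j] by (simp add: power2_eq_square)
    then show ?thesis
      using M_pos max[OF that(1)] by (simp add: M_def)
  qed
qed

text \<open>
  A row with negative sum is where mass leaks out, and every row has to reach one along positive
  entries: otherwise the rows reachable from some row would form a diagonal block of a block
  triangular matrix with all row sums zero, and \<open>0\<close> would be an eigenvalue. The proof follows such a
  path from a row of maximal modulus; maximality is passed on to the leaking row at its end, where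
  the maximum principle forces the row sum to be zero.
\<close>

lemma Re_eigenvalue_neg_of_leaking_subgenerator:
  fixes A :: "real mat" and k :: complex
  assumes A: "A \<in> carrier_mat n n"
    and off_diag: "\<And>i j. i < n \<Longrightarrow> j < n \<Longrightarrow> j \<noteq> i \<Longrightarrow> A $$ (i, j) \<ge> 0"
    and row_sum: "\<And>i. i < n \<Longrightarrow> (\<Sum>j<n. A $$ (i, j)) \<le> 0"
    and leak: "\<And>i. i < n \<Longrightarrow> \<exists>s<n. (i, s) \<in> {(i, j). i < n \<and> j < n \<and> A $$ (i, j) > 0}\<^sup>*
                 \<and> (\<Sum>j<n. A $$ (s, j)) < 0"
    and eigen: "eigenvalue (map_mat complex_of_real A) k"
  shows "Re k < 0"
proof (rule ccontr)
  assume "\<not> Re k < 0"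
  then have Re_k: "Re k \<ge> 0" by simp
  obtain v where v: "v \<in> carrier_vec n" "v \<noteq> 0\<^sub>v n"
    and Av: "map_mat complex_of_real A *\<^sub>v v = k \<cdot>\<^sub>v v"
    using eigen A unfolding eigenvalue_def eigenvector_def by auto
  have row_eq: "(\<Sum>j<n. of_real (A $$ (i, j)) * v $ j) = k * v $ i" if "i < n" for i
    using arg_cong[OF Av, of "\<lambda>w. w $ i"] that A v(1)
    by (simp add: scalar_prod_def lessThan_atLeast0)
  obtain p where p: "p < n" "v $ p \<noteq> 0"
    using v by (metis eq_vecI carrier_vecD index_zero_vec(1,2))
  let ?M = "Max ((\<lambda>j. cmod (v $ j)) ` {..<n})"
  have le_M: "cmod (v $ j) \<le> ?M" if "j < n" for j
    using that by (intro Max_ge) auto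
  have M_pos: "?M > 0"
    using le_M[OF p(1)] p(2) by (meson less_le_trans zero_less_norm_iff)
  have "?M \<in> (\<lambda>j. cmod (v $ j)) ` {..<n}"
    using p(1) by (intro Max_in) auto
  then obtain m where m: "m < n" "cmod (v $ m) = ?M" by auto
  have maximal_row: "(\<Sum>j<n. A $$ (i, j)) = 0"
      "\<And>j. j < n \<Longrightarrow> A $$ (i, j) > 0 \<Longrightarrow> cmod (v $ j) = ?M"
    if i: "i < n" "cmod (v $ i) = ?M" for i
  proof -
    have nonzero: "v $ i \<noteq> 0" using i(2) M_pos by auto
    have max: "cmod (v $ j) \<le> cmod (v $ i)" if "j < n" for j
      using le_M[OF that] i(2) by simp
    note principle = eigenvector_maximum_principle
      [OF row_eq[OF i(1)] off_diag[OF i(1)] row_sum[OF i(1)] max nonzero Re_k]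
    show "(\<Sum>j<n. A $$ (i, j)) = 0"
      by (rule principle(1))
    show "cmod (v $ j) = ?M" if "j < n" "A $$ (i, j) > 0" for j
      using principle(2) that i(2) by simp
  qed
  obtain s where s: "s < n" "(\<Sum>j<n. A $$ (s, j)) < 0"
    "(m, s) \<in> {(i, j). i < n \<and> j < n \<and> A $$ (i, j) > 0}\<^sup>*"
    using leak[OF m(1)] by blast
  from s(3) have "cmod (v $ s) = ?M"
  proof (induction rule: rtrancl_induct)
    case base
    show ?case by (fact m(2))
  next
    case (step i j)
    then show ?case using maximal_row(2)[of i j] by blast
  qed
  then show False
    using maximal_row(1)[OF s(1)] s(2) by simp
qed

section \<open>The matrix B\<close>

text \<open>
  Away from row \<open>0\<close> the case distinctions of the definition amount to one superposition. In
  row \<open>1\<close> the terms \<open>bz 1\<close> and \<open>bd 1\<close> both fall on column \<open>0\<close> and add up there.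
\<close>

lemma B_entry_superposition:
  assumes "i \<ge> 1"
  shows "B_entry bd bu bz i j =
    (if j = 0 then bz i else 0) + (if j = i - 1 then bd i else 0)
    + (if j = i then - bw bd bu bz i else 0) + (if j = i + 1 then bu i else 0)"
  using assms unfolding B_entry_def by auto

lemma B_entry_row_sum_0:
  assumes "l \<ge> 1"
  shows "(\<Sum>j<l + 1. B_entry bd bu bz 0 j) = - bd 0"
proof -
  have "B_entry bd bu bz 0 j = (if j = 0 then - bd 0 - bu 0 else 0) + (if j = 1 then bu 0 else 0)"
    for j by (simp add: B_entry_def)
  then show ?thesis
    using assms by (simp add: sum.distrib)
qed

lemma B_entry_row_sum_pos:
  assumes "1 \<le> i" "i \<le> l" "bu l = 0"
  shows "(\<Sum>j<l + 1. B_entry bd bu bz i j) = 0"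
proof -
  \<comment> \<open>In the last row the superdiagonal column lies outside the matrix, but there \<open>bu l\<close> is zero.\<close>
  have "i < l \<or> bu i = 0"
    using assms by (cases "i = l") auto
  then show ?thesis
    using assms(1,2) by (auto simp: B_entry_superposition sum.distrib bw_def)
qed

theorem theorem1:
  fixes l :: nat and bd bu bz :: "nat \<Rightarrow> real" and k :: complex
  assumes "l \<ge> 1"
    and "\<And>i. i \<le> l \<Longrightarrow> bd i \<ge> 0"
    and "\<And>i. i \<le> l \<Longrightarrow> bu i \<ge> 0"
    and "\<And>i. i \<le> l \<Longrightarrow> bz i \<ge> 0"
    and "bd 0 > 0"
    and "bu l = 0"
    and "\<And>i. 1 \<le> i \<Longrightarrow> i \<le> l \<Longrightarrow> bw bd bu bz i > 0"
    and "\<And>i. 1 \<le> i \<Longrightarrow> i \<le> l \<Longrightarrow> bd i * bu (i - 1) > 0"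
    and "eigenvalue (map_mat complex_of_real (B_mat l bd bu bz)) k"
  shows "Re k < 0"
proof (rule Re_eigenvalue_neg_of_leaking_subgenerator[OF _ _ _ _ assms(9)])
  let ?B = "B_mat l bd bu bz"
  let ?E = "{(i, j). i < l + 1 \<and> j < l + 1 \<and> ?B $$ (i, j) > 0}"
  show "?B \<in> carrier_mat (l + 1) (l + 1)"
    by (simp add: B_mat_def)
  have entry: "?B $$ (i, j) = B_entry bd bu bz i j" if "i < l + 1" "j < l + 1" for i j
    using that by (simp add: B_mat_def)
  show "?B $$ (i, j) \<ge> 0" if "i < l + 1" "j < l + 1" "j \<noteq> i" for i j
    using that assms(2-4)[of i] assms(2-4)[of 1]
    by (cases "i = 0") (auto simp: entry B_entry_superposition, auto simp: B_entry_def)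
  have row_sum: "(\<Sum>j<l + 1. ?B $$ (i, j)) = (if i = 0 then - bd 0 else 0)" if "i < l + 1" for i
  proof -
    have "(\<Sum>j<l + 1. ?B $$ (i, j)) = (\<Sum>j<l + 1. B_entry bd bu bz i j)"
      using that by (intro sum.cong) (auto simp: entry)
    then show ?thesis
      using that B_entry_row_sum_0[OF assms(1)] B_entry_row_sum_pos[of i l bu bd bz] assms(6)
      by (cases "i = 0") auto
  qed
  then show "(\<Sum>j<l + 1. ?B $$ (i, j)) \<le> 0" if "i < l + 1" for i
    using that assms(5) by simp
  have descent: "(i, 0) \<in> ?E\<^sup>*" if "i \<le> l" for i
    using that
  proof (induction i)
    case (Suc i)
    have "bd (Suc i) > 0"
      using assms(8)[of "Suc i"] assms(2)[of "Suc i"] Suc.prems by (simp add: zero_less_mult_iff)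
    then have "(Suc i, i) \<in> ?E"
      using Suc.prems assms(4)[of "Suc i"]
      by (auto simp: entry B_entry_superposition add_nonneg_pos)
    then show ?case
      using Suc.IH Suc.prems by (simp add: converse_rtrancl_into_rtrancl del: mem_Collect_eq)
  qed simp
  show "\<exists>s<l + 1. (i, s) \<in> ?E\<^sup>* \<and> (\<Sum>j<l + 1. ?B $$ (s, j)) < 0" if "i < l + 1" for i
  proof (intro exI conjI)
    show "(i, 0) \<in> ?E\<^sup>*"
      using descent that by simp
    show "(\<Sum>j<l + 1. ?B $$ (0, j)) < 0"
      using row_sum[of 0] assms(5) by simp
  qed simp
qed

end
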